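(* Let $R$ be an arithmetical ring for which $\mathrm{Max}\,R$ is Noetherian in the Zariski topology. Then for each proper ideal $A$ of $R$, the set of irreducible ideals that are minimal over $A$ is a strongly irredundant representation of $A$, and this is the unique irredundant representation of $A$ as an intersection of irreducible ideals.
   Context: Rings are commutative with identity. A ring $R$ is arithmetical if for each maximal ideal $M$ of $R$ the ideals of $R_M$ form a chain under inclusion. $\mathrm{Max}\,R$ is the set of maximal ideals, a subspace of $\mathrm{Spec}\,R$; a space is Noetherian if its open sets satisfy the ascending chain condition. An ideal is irreducible if it is not an intersection of two ideals properly containing it. $\mathrm{Irr}\,R$ is the set of proper irreducible ideals of $R$, topologized by taking as a basis of closed sets the sets $\mathcal V(I) = \{B \in \mathrm{Irr}\,R : I \subseteq B\}$, $I$ ranging over all ideals of $R$. The irreducible ideals minimal over $A$ are the elements of $\mathcal V(A)$ minimal under inclusion. A representation of a proper ideal $A$ is a subset of $\mathrm{Irr}\,R$ whose intersection is $A$ (an empty intersection is $R$). A member $B$ of a representation $Z$ of $A$ is irredundant in $Z$ if $Z \setminus \{B\}$ is not a representation of $A$; it is strongly irredundant in $Z$ if the only closed subset $Y$ of $\mathcal V(B)$ such that $(Z\setminus\{B\}) \cup Y$ is a representation of $A$ is $Y = \mathcal V(B)$. A representation is irredundant (resp. strongly irredundant) if each of its members is irredundant (resp. strongly irredundant) in it. *)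

theory Defs
  imports "HOL-Algebra.Ideal" "HOL-Analysis.Abstract_Topology"
begin

definition loc_rel :: "('a, 'm) ring_scheme \<Rightarrow> 'a set \<Rightarrow> (('a \<times> 'a) \<times> ('a \<times> 'a)) set"
  where "loc_rel R S = {((a, s), (b, t)). a \<in> carrier R \<and> s \<in> S \<and> b \<in> carrier R \<and> t \<in> S \<and>
    (\<exists>u \<in> S. u \<otimes>\<^bsub>R\<^esub> (a \<otimes>\<^bsub>R\<^esub> t) = u \<otimes>\<^bsub>R\<^esub> (b \<otimes>\<^bsub>R\<^esub> s))}"

definition loc_frac :: "('a, 'm) ring_scheme \<Rightarrow> 'a set \<Rightarrow> 'a \<Rightarrow> 'a \<Rightarrow> ('a \<times> 'a) set"
  where "loc_frac R S a s = loc_rel R S `` {(a, s)}"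

text \<open>
  The unions below run over all representatives of the two fractions; by well-definedness
  they are unions of copies of one and the same equivalence class.
\<close>

definition localization :: "('a, 'm) ring_scheme \<Rightarrow> 'a set \<Rightarrow> ('a \<times> 'a) set ring"
  where "localization R S =
    \<lparr> carrier = (carrier R \<times> S) // loc_rel R S,
      mult = (\<lambda>X Y. \<Union>(a, s) \<in> X. \<Union>(b, t) \<in> Y. loc_frac R S (a \<otimes>\<^bsub>R\<^esub> b) (s \<otimes>\<^bsub>R\<^esub> t)),
      one = loc_frac R S \<one>\<^bsub>R\<^esub> \<one>\<^bsub>R\<^esub>,
      zero = loc_frac R S \<zero>\<^bsub>R\<^esub> \<one>\<^bsub>R\<^esub>,
      add = (\<lambda>X Y. \<Union>(a, s) \<in> X. \<Union>(b, t) \<in> Y.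
        loc_frac R S ((a \<otimes>\<^bsub>R\<^esub> t) \<oplus>\<^bsub>R\<^esub> (b \<otimes>\<^bsub>R\<^esub> s)) (s \<otimes>\<^bsub>R\<^esub> t)) \<rparr>"

abbreviation localization_at :: "('a, 'm) ring_scheme \<Rightarrow> 'a set \<Rightarrow> ('a \<times> 'a) set ring"
  where "localization_at R P \<equiv> localization R (carrier R - P)"

locale mult_set = cring R for R (structure) and S +
  assumes S_sub: "S \<subseteq> carrier R"
    and S_one: "\<one> \<in> S"
    and S_mult: "s \<in> S \<Longrightarrow> t \<in> S \<Longrightarrow> s \<otimes> t \<in> S"
begin

lemma S_carrier: "s \<in> S \<Longrightarrow> s \<in> carrier R"
  using S_sub by blast

lemma loc_equiv: "equiv (carrier R \<times> S) (loc_rel R S)"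
proof (rule equivI)
  show "loc_rel R S \<subseteq> (carrier R \<times> S) \<times> (carrier R \<times> S)"
    by (auto simp: loc_rel_def)
  show "refl_on (carrier R \<times> S) (loc_rel R S)"
    using S_one by (auto simp: refl_on_def loc_rel_def)
  show "sym (loc_rel R S)"
  proof (rule symI)
    fix x y assume "(x, y) \<in> loc_rel R S"
    then show "(y, x) \<in> loc_rel R S" unfolding loc_rel_def by (auto dest: sym)
  qed
  show "trans (loc_rel R S)"
  proof (rule transI)
    fix x y z assume "(x, y) \<in> loc_rel R S" "(y, z) \<in> loc_rel R S"
    then obtain a s b t c r u v where
      xyz: "x = (a, s)" "y = (b, t)" "z = (c, r)" and
      S: "s \<in> S" "t \<in> S" "r \<in> S" "u \<in> S" "v \<in> S" and
      abc: "a \<in> carrier R" "b \<in> carrier R" "c \<in> carrier R" and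
      e: "u \<otimes> (a \<otimes> t) = u \<otimes> (b \<otimes> s)" "v \<otimes> (b \<otimes> r) = v \<otimes> (c \<otimes> t)"
      by (auto simp: loc_rel_def)
    note SC = S[THEN S_carrier]
    have "(u \<otimes> v \<otimes> t) \<otimes> (a \<otimes> r) = (u \<otimes> (a \<otimes> t)) \<otimes> (v \<otimes> r)"
      using SC abc by (simp add: m_ac)
    also have "\<dots> = (v \<otimes> (b \<otimes> r)) \<otimes> (u \<otimes> s)"
      unfolding e(1) using SC abc by (simp add: m_ac)
    also have "\<dots> = (u \<otimes> v \<otimes> t) \<otimes> (c \<otimes> s)"
      unfolding e(2) using SC abc by (simp add: m_ac)
    finally show "(x, z) \<in> loc_rel R S"
      using S abc S_mult unfolding xyz loc_rel_def by blast
  qed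
qed

lemma loc_frac_eqI:
  assumes "((a, s), (b, t)) \<in> loc_rel R S"
  shows "loc_frac R S a s = loc_frac R S b t"
  unfolding loc_frac_def by (rule equiv_class_eq[OF loc_equiv assms])

lemma loc_frac_eqI':
  assumes "a \<in> carrier R" "s \<in> S" "b \<in> carrier R" "t \<in> S" "a \<otimes> t = b \<otimes> s"
  shows "loc_frac R S a s = loc_frac R S b t"
  using assms S_one by (intro loc_frac_eqI) (auto simp: loc_rel_def)

lemma loc_mult_congruent:
  "(\<lambda>x y. case x of (a, s) \<Rightarrow> case y of (b, t) \<Rightarrow> loc_frac R S (a \<otimes> b) (s \<otimes> t))
    respects2 loc_rel R S"
proof (rule congruent2_commuteI[OF loc_equiv]; clarify)
  fix a s a' s' b t
  assume "((a, s), (a', s')) \<in> loc_rel R S" and bt: "b \<in> carrier R" "t \<in> S"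
  then obtain u where S: "s \<in> S" "s' \<in> S" "u \<in> S" and aa: "a \<in> carrier R" "a' \<in> carrier R"
    and e: "u \<otimes> (a \<otimes> s') = u \<otimes> (a' \<otimes> s)"
    by (auto simp: loc_rel_def)
  note SC = S[THEN S_carrier] bt(2)[THEN S_carrier]
  have "u \<otimes> ((a \<otimes> b) \<otimes> (s' \<otimes> t)) = (u \<otimes> (a \<otimes> s')) \<otimes> (b \<otimes> t)"
    using SC aa bt by (simp add: m_ac)
  also have "\<dots> = u \<otimes> ((a' \<otimes> b) \<otimes> (s \<otimes> t))"
    unfolding e using SC aa bt by (simp add: m_ac)
  finally have e': "u \<otimes> ((a \<otimes> b) \<otimes> (s' \<otimes> t)) = u \<otimes> ((a' \<otimes> b) \<otimes> (s \<otimes> t))" .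
  have *: "loc_frac R S (a \<otimes> b) (s \<otimes> t) = loc_frac R S (a' \<otimes> b) (s' \<otimes> t)"
    using e' S bt aa S_mult by (intro loc_frac_eqI) (auto simp: loc_rel_def)
  show "loc_frac R S (b \<otimes> a) (t \<otimes> s) = loc_frac R S (b \<otimes> a') (t \<otimes> s')"
    using * SC aa bt by (simp add: m_comm)
next
  fix a s b t assume "a \<in> carrier R" "s \<in> S" "b \<in> carrier R" "t \<in> S"
  then show "loc_frac R S (a \<otimes> b) (s \<otimes> t) = loc_frac R S (b \<otimes> a) (t \<otimes> s)"
    by (simp add: S_carrier m_comm)
qed

lemma loc_add_congruent:
  "(\<lambda>x y. case x of (a, s) \<Rightarrow> case y of (b, t) \<Rightarrow> loc_frac R S ((a \<otimes> t) \<oplus> (b \<otimes> s)) (s \<otimes> t))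
    respects2 loc_rel R S"
proof (rule congruent2_commuteI[OF loc_equiv]; clarify)
  fix a s a' s' b t
  assume "((a, s), (a', s')) \<in> loc_rel R S" and bt: "b \<in> carrier R" "t \<in> S"
  then obtain u where S: "s \<in> S" "s' \<in> S" "u \<in> S" and aa: "a \<in> carrier R" "a' \<in> carrier R"
    and e: "u \<otimes> (a \<otimes> s') = u \<otimes> (a' \<otimes> s)"
    by (auto simp: loc_rel_def)
  note SC = S[THEN S_carrier] bt(2)[THEN S_carrier]
  have "u \<otimes> (((a \<otimes> t) \<oplus> (b \<otimes> s)) \<otimes> (s' \<otimes> t))
      = (u \<otimes> (a \<otimes> s')) \<otimes> (t \<otimes> t) \<oplus> u \<otimes> (b \<otimes> s \<otimes> s' \<otimes> t)"
    using SC aa bt by (simp add: m_ac l_distr r_distr)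
  also have "\<dots> = u \<otimes> (((a' \<otimes> t) \<oplus> (b \<otimes> s')) \<otimes> (s \<otimes> t))"
    unfolding e using SC aa bt by (simp add: m_ac l_distr r_distr)
  finally have e': "u \<otimes> (((a \<otimes> t) \<oplus> (b \<otimes> s)) \<otimes> (s' \<otimes> t))
    = u \<otimes> (((a' \<otimes> t) \<oplus> (b \<otimes> s')) \<otimes> (s \<otimes> t))" .
  have *: "loc_frac R S ((a \<otimes> t) \<oplus> (b \<otimes> s)) (s \<otimes> t)
      = loc_frac R S ((a' \<otimes> t) \<oplus> (b \<otimes> s')) (s' \<otimes> t)"
    using e' S bt aa SC S_mult by (intro loc_frac_eqI) (auto simp: loc_rel_def)
  show "loc_frac R S ((b \<otimes> s) \<oplus> (a \<otimes> t)) (t \<otimes> s)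
      = loc_frac R S ((b \<otimes> s') \<oplus> (a' \<otimes> t)) (t \<otimes> s')"
    using * SC aa bt by (simp add: m_comm a_comm)
next
  fix a s b t assume "a \<in> carrier R" "s \<in> S" "b \<in> carrier R" "t \<in> S"
  then show "loc_frac R S ((a \<otimes> t) \<oplus> (b \<otimes> s)) (s \<otimes> t)
      = loc_frac R S ((b \<otimes> s) \<oplus> (a \<otimes> t)) (t \<otimes> s)"
    by (simp add: S_carrier m_comm a_comm)
qed

lemma loc_mult:
  assumes "a \<in> carrier R" "s \<in> S" "b \<in> carrier R" "t \<in> S"
  shows "loc_frac R S a s \<otimes>\<^bsub>localization R S\<^esub> loc_frac R S b t = loc_frac R S (a \<otimes> b) (s \<otimes> t)"
  using UN_equiv_class2[OF loc_equiv loc_equiv loc_mult_congruent, of "(a, s)" "(b, t)"] assms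
  by (simp add: localization_def loc_frac_def[of R S a] loc_frac_def[of R S b] case_prod_unfold)

lemma loc_add:
  assumes "a \<in> carrier R" "s \<in> S" "b \<in> carrier R" "t \<in> S"
  shows "loc_frac R S a s \<oplus>\<^bsub>localization R S\<^esub> loc_frac R S b t
    = loc_frac R S ((a \<otimes> t) \<oplus> (b \<otimes> s)) (s \<otimes> t)"
  using UN_equiv_class2[OF loc_equiv loc_equiv loc_add_congruent, of "(a, s)" "(b, t)"] assms
  by (simp add: localization_def loc_frac_def[of R S a] loc_frac_def[of R S b] case_prod_unfold)

lemma loc_one: "\<one>\<^bsub>localization R S\<^esub> = loc_frac R S \<one> \<one>"
  and loc_zero: "\<zero>\<^bsub>localization R S\<^esub> = loc_frac R S \<zero> \<one>"
  by (simp_all add: localization_def)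

lemma loc_carrier: "X \<in> carrier (localization R S) \<longleftrightarrow> (\<exists>a \<in> carrier R. \<exists>s \<in> S. X = loc_frac R S a s)"
  by (auto simp: localization_def quotient_def loc_frac_def)

lemma loc_fracI: "a \<in> carrier R \<Longrightarrow> s \<in> S \<Longrightarrow> loc_frac R S a s \<in> carrier (localization R S)"
  using loc_carrier by blast

lemma cring_localization: "cring (localization R S)"
proof (rule cringI)
  note [simp] = loc_mult loc_add loc_one loc_zero S_carrier S_one S_mult loc_fracI
  let ?L = "localization R S"
  have elim: "\<exists>a s. a \<in> carrier R \<and> s \<in> S \<and> X = loc_frac R S a s" if "X \<in> carrier ?L" for X
    using that loc_carrier by blast
  show "abelian_group ?L"
  proof (rule abelian_groupI)
    fix X Y assume "X \<in> carrier ?L" "Y \<in> carrier ?L"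
    then obtain a s b t where *: "a \<in> carrier R" "s \<in> S" "b \<in> carrier R" "t \<in> S"
      "X = loc_frac R S a s" "Y = loc_frac R S b t" by (metis elim)
    show "X \<oplus>\<^bsub>?L\<^esub> Y \<in> carrier ?L" using * by simp
    show "X \<oplus>\<^bsub>?L\<^esub> Y = Y \<oplus>\<^bsub>?L\<^esub> X" using * by (simp add: m_comm a_comm)
    fix Z assume "Z \<in> carrier ?L"
    then obtain c r where **: "c \<in> carrier R" "r \<in> S" "Z = loc_frac R S c r" by (metis elim)
    show "(X \<oplus>\<^bsub>?L\<^esub> Y) \<oplus>\<^bsub>?L\<^esub> Z = X \<oplus>\<^bsub>?L\<^esub> (Y \<oplus>\<^bsub>?L\<^esub> Z)"
      using * ** by (simp add: m_ac a_ac l_distr r_distr)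
  next
    show "\<zero>\<^bsub>?L\<^esub> \<in> carrier ?L" by simp
  next
    fix X assume "X \<in> carrier ?L"
    then obtain a s where *: "a \<in> carrier R" "s \<in> S" "X = loc_frac R S a s" by (metis elim)
    show "\<zero>\<^bsub>?L\<^esub> \<oplus>\<^bsub>?L\<^esub> X = X" using * by simp
    have "loc_frac R S (\<ominus> a) s \<oplus>\<^bsub>?L\<^esub> X = loc_frac R S ((\<ominus> a) \<otimes> s \<oplus> a \<otimes> s) (s \<otimes> s)"
      using * by simp
    also have "(\<ominus> a) \<otimes> s \<oplus> a \<otimes> s = \<zero>" using * by (simp add: l_minus l_neg)
    also have "loc_frac R S \<zero> (s \<otimes> s) = \<zero>\<^bsub>?L\<^esub>"
      unfolding loc_zero using * by (intro loc_frac_eqI') auto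
    finally show "\<exists>Y \<in> carrier ?L. Y \<oplus>\<^bsub>?L\<^esub> X = \<zero>\<^bsub>?L\<^esub>" using * by (meson a_inv_closed loc_fracI)
  qed
  show "comm_monoid ?L"
  proof (rule comm_monoidI)
    fix X Y assume "X \<in> carrier ?L" "Y \<in> carrier ?L"
    then obtain a s b t where *: "a \<in> carrier R" "s \<in> S" "b \<in> carrier R" "t \<in> S"
      "X = loc_frac R S a s" "Y = loc_frac R S b t" by (metis elim)
    show "X \<otimes>\<^bsub>?L\<^esub> Y \<in> carrier ?L" using * by simp
    show "X \<otimes>\<^bsub>?L\<^esub> Y = Y \<otimes>\<^bsub>?L\<^esub> X" using * by (simp add: m_comm)
    fix Z assume "Z \<in> carrier ?L"
    then obtain c r where **: "c \<in> carrier R" "r \<in> S" "Z = loc_frac R S c r" by (metis elim)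
    show "(X \<otimes>\<^bsub>?L\<^esub> Y) \<otimes>\<^bsub>?L\<^esub> Z = X \<otimes>\<^bsub>?L\<^esub> (Y \<otimes>\<^bsub>?L\<^esub> Z)"
      using * ** by (simp add: m_ac)
  next
    show "\<one>\<^bsub>?L\<^esub> \<in> carrier ?L" by simp
  next
    fix X assume "X \<in> carrier ?L"
    then obtain a s where *: "a \<in> carrier R" "s \<in> S" "X = loc_frac R S a s" by (metis elim)
    show "\<one>\<^bsub>?L\<^esub> \<otimes>\<^bsub>?L\<^esub> X = X" using * by simp
  qed
  fix X Y Z assume "X \<in> carrier ?L" "Y \<in> carrier ?L" "Z \<in> carrier ?L"
  then obtain a s b t c r where *: "a \<in> carrier R" "s \<in> S" "b \<in> carrier R" "t \<in> S"
    "X = loc_frac R S a s" "Y = loc_frac R S b t" "c \<in> carrier R" "r \<in> S" "Z = loc_frac R S c r"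
    by (metis elim)
  show "(X \<oplus>\<^bsub>?L\<^esub> Y) \<otimes>\<^bsub>?L\<^esub> Z = X \<otimes>\<^bsub>?L\<^esub> Z \<oplus>\<^bsub>?L\<^esub> Y \<otimes>\<^bsub>?L\<^esub> Z"
    using * by simp (rule loc_frac_eqI'; simp add: m_ac l_distr r_distr)
qed

end

text \<open>
  The predicate \<open>ideal I L\<close> includes that \<open>L\<close> is a ring, so quantifying over the ideals of a
  localization as below is only meaningful because of the following fact.
\<close>

lemma cring_localization_at:
  fixes R (structure)
  assumes "primeideal P R" shows "cring (localization_at R P)"
proof -
  interpret primeideal P R by fact
  have "mult_set R (carrier R - P)"
  proof (intro mult_set.intro mult_set_axioms.intro)
    show "cring R" by (rule is_cring)
    show "carrier R - P \<subseteq> carrier R" by blast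
    show "\<one> \<in> carrier R - P" using I_notcarr one_imp_carrier by blast
    fix s t assume "s \<in> carrier R - P" "t \<in> carrier R - P"
    then show "s \<otimes> t \<in> carrier R - P" using I_prime by blast
  qed
  then show ?thesis by (rule mult_set.cring_localization)
qed


definition arithmetical_ring :: "('a, 'm) ring_scheme \<Rightarrow> bool"
  where "arithmetical_ring R \<longleftrightarrow> cring R \<and>
    (\<forall>M. maximalideal M R \<longrightarrow>
      (\<forall>I J. ideal I (localization_at R M) \<longrightarrow> ideal J (localization_at R M) \<longrightarrow> I \<subseteq> J \<or> J \<subseteq> I))"


definition Spec :: "('a, 'm) ring_scheme \<Rightarrow> 'a set set"
  where "Spec R = {P. primeideal P R}"

definition zariski :: "('a, 'm) ring_scheme \<Rightarrow> 'a set topology"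
  where "zariski R = topology_generated_by {{P \<in> Spec R. \<not> I \<subseteq> P} | I. ideal I R}"

definition MaxSpec :: "('a, 'm) ring_scheme \<Rightarrow> 'a set set"
  where "MaxSpec R = {M. maximalideal M R}"

definition zariski_Max :: "('a, 'm) ring_scheme \<Rightarrow> 'a set topology"
  where "zariski_Max R = subtopology (zariski R) (MaxSpec R)"

definition noetherian_space :: "'b topology \<Rightarrow> bool"
  where "noetherian_space X \<longleftrightarrow>
    (\<forall>U :: nat \<Rightarrow> 'b set. (\<forall>n. openin X (U n)) \<and> (\<forall>n. U n \<subseteq> U (Suc n)) \<longrightarrow>
      (\<exists>N. \<forall>n \<ge> N. U n = U N))"

definition irreducible_ideal :: "'a set \<Rightarrow> ('a, 'm) ring_scheme \<Rightarrow> bool"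
  where "irreducible_ideal B R \<longleftrightarrow> ideal B R \<and>
    \<not> (\<exists>I J. ideal I R \<and> ideal J R \<and> B \<subset> I \<and> B \<subset> J \<and> B = I \<inter> J)"

definition Irr :: "('a, 'm) ring_scheme \<Rightarrow> 'a set set"
  where "Irr R = {B. irreducible_ideal B R \<and> B \<noteq> carrier R}"

definition V_Irr :: "('a, 'm) ring_scheme \<Rightarrow> 'a set \<Rightarrow> 'a set set"
  where "V_Irr R I = {B \<in> Irr R. I \<subseteq> B}"

text \<open>
  The coarsest topology in which the sets \<open>V_Irr R I\<close> are closed. If these sets are
  closed under finite unions (as they are in an arithmetical ring), they are a basis of its
  closed sets, and since they are always closed under intersections, they are then all of its
  closed sets.
\<close>

definition irr_topology :: "('a, 'm) ring_scheme \<Rightarrow> 'a set topology"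
  where "irr_topology R = topology_generated_by {Irr R - V_Irr R I | I. ideal I R}"

definition minimal_irr_over :: "('a, 'm) ring_scheme \<Rightarrow> 'a set \<Rightarrow> 'a set set"
  where "minimal_irr_over R A = {B \<in> V_Irr R A. \<forall>C \<in> V_Irr R A. C \<subseteq> B \<longrightarrow> C = B}"

lemma topspace_irr_topology:
  assumes "ring R" shows "topspace (irr_topology R) = Irr R"
proof -
  have "ideal (carrier R) R" using assms by (rule ring.oneideal)
  moreover have "V_Irr R (carrier R) = {}"
  proof -
    have "carrier R = B" if "ideal B R" "carrier R \<subseteq> B" for B
      using that ideal.Icarr[OF that(1)] by blast
    then show ?thesis unfolding V_Irr_def Irr_def irreducible_ideal_def by blast
  qed
  ultimately show ?thesis
    unfolding irr_topology_def topology_generated_by_topspace by blast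
qed

lemma openin_zariski:
  fixes R (structure)
  assumes "cring R"
  shows "openin (zariski R) U \<longleftrightarrow> (\<exists>I. ideal I R \<and> U = {P \<in> Spec R. \<not> I \<subseteq> P})"
proof
  interpret cring R by fact
  assume "openin (zariski R) U"
  then have "generate_topology_on {{P \<in> Spec R. \<not> I \<subseteq> P} | I. ideal I R} U"
    unfolding zariski_def openin_topology_generated_by_iff .
  then show "\<exists>I. ideal I R \<and> U = {P \<in> Spec R. \<not> I \<subseteq> P}"
  proof induction
    case Empty
    have "\<zero> \<in> P" if "P \<in> Spec R" for P
      using that additive_subgroup.zero_closed[OF ideal.axioms(1)[OF primeideal.axioms(1)]]
      by (simp add: Spec_def)
    then have "{} = {P \<in> Spec R. \<not> {\<zero>} \<subseteq> P}" by blast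
    then show ?case using zeroideal by blast
  next
    case (Int U W)
    then obtain I J where I: "ideal I R" "U = {P \<in> Spec R. \<not> I \<subseteq> P}"
      and J: "ideal J R" "W = {P \<in> Spec R. \<not> J \<subseteq> P}" by blast
    have "U \<inter> W = {P \<in> Spec R. \<not> I \<inter> J \<subseteq> P}"
    proof -
      have False if P: "primeideal P R" "I \<inter> J \<subseteq> P" "a \<in> I - P" "b \<in> J - P" for P a b
      proof -
        have ab: "a \<in> carrier R" "b \<in> carrier R" using P ideal.Icarr[OF I(1)] ideal.Icarr[OF J(1)] by blast+
        have "a \<otimes> b \<in> I \<inter> J"
          using P(3,4) ab ideal.I_l_closed[OF J(1)] ideal.I_r_closed[OF I(1)] by blast
        then show False using P(2,3,4) ab primeideal.I_prime[OF P(1)] by blast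
      qed
      then show ?thesis unfolding I(2) J(2) Spec_def by blast
    qed
    then show ?case using i_intersect[OF I(1) J(1)] by blast
  next
    case (UN K)
    then have "\<forall>k \<in> K. \<exists>I. ideal I R \<and> k = {P \<in> Spec R. \<not> I \<subseteq> P}" by blast
    then obtain F where "\<forall>k \<in> K. ideal (F k) R \<and> k = {P \<in> Spec R. \<not> F k \<subseteq> P}"
      unfolding bchoice_iff by blast
    then have F: "ideal (F k) R" "k = {P \<in> Spec R. \<not> F k \<subseteq> P}" if "k \<in> K" for k
      using that by blast+
    let ?S = "\<Union>k \<in> K. F k"
    have sub: "?S \<subseteq> carrier R" using ideal.Icarr[OF F(1)] by blast
    have "\<Union>K = (\<Union>k \<in> K. {P \<in> Spec R. \<not> F k \<subseteq> P})" using F(2) by auto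
    also have "\<dots> = {P \<in> Spec R. \<not> ?S \<subseteq> P}" by blast
    also have "\<dots> = {P \<in> Spec R. \<not> Idl ?S \<subseteq> P}"
      using Idl_subset_ideal[OF _ sub] primeideal.axioms(1) by (auto simp: Spec_def)
    finally show ?case using genideal_ideal[OF sub] by blast
  next
    case (Basis s) then show ?case by blast
  qed
next
  assume "\<exists>I. ideal I R \<and> U = {P \<in> Spec R. \<not> I \<subseteq> P}"
  then show "openin (zariski R) U"
    unfolding zariski_def by (blast intro: topology_generated_by_Basis)
qed


text \<open>Intersecting with \<open>carrier R\<close> makes the empty intersection equal to the whole ring.\<close>

definition representation :: "('a, 'm) ring_scheme \<Rightarrow> 'a set \<Rightarrow> 'a set set \<Rightarrow> bool"
  where "representation R A Z \<longleftrightarrow> Z \<subseteq> Irr R \<and> carrier R \<inter> \<Inter>Z = A"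

definition irredundant_in :: "('a, 'm) ring_scheme \<Rightarrow> 'a set \<Rightarrow> 'a set set \<Rightarrow> 'a set \<Rightarrow> bool"
  where "irredundant_in R A Z B \<longleftrightarrow> \<not> representation R A (Z - {B})"

definition strongly_irredundant_in :: "('a, 'm) ring_scheme \<Rightarrow> 'a set \<Rightarrow> 'a set set \<Rightarrow> 'a set \<Rightarrow> bool"
  where "strongly_irredundant_in R A Z B \<longleftrightarrow>
    (\<forall>Y. closedin (subtopology (irr_topology R) (V_Irr R B)) Y \<and>
         representation R A ((Z - {B}) \<union> Y) \<longleftrightarrow> Y = V_Irr R B)"

definition irredundant_representation :: "('a, 'm) ring_scheme \<Rightarrow> 'a set \<Rightarrow> 'a set set \<Rightarrow> bool"
  where "irredundant_representation R A Z \<longleftrightarrow>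
    representation R A Z \<and> (\<forall>B \<in> Z. irredundant_in R A Z B)"

definition strongly_irredundant_representation ::
    "('a, 'm) ring_scheme \<Rightarrow> 'a set \<Rightarrow> 'a set set \<Rightarrow> bool"
  where "strongly_irredundant_representation R A Z \<longleftrightarrow>
    representation R A Z \<and> (\<forall>B \<in> Z. strongly_irredundant_in R A Z B)"

end

theory Submission
  imports Defs "HOL-Algebra.Ring_Divisibility"
begin

text \<open>
  In an arithmetical ring the saturation \<open>A\<^sub>M\<close> (the preimage in \<open>R\<close> of the extension of \<open>A\<close>
  to the localization at \<open>M\<close>) is irreducible for every maximal \<open>M\<close> above \<open>A\<close>, every irreducible
  ideal is of this form, and irreducible ideals are prime elements for intersection. The key step
  is that an ideal \<open>J\<close> not contained in a minimal irreducible \<open>B\<close> over \<open>A\<close> has an element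
  outside \<open>B\<close> that lies in every irreducible ideal over \<open>A\<close> not containing \<open>B\<close>; the descending
  chain condition on closed sets of maximal ideals produces it. Hence \<open>B\<close> cannot be replaced by
  anything larger, and an irredundant representation avoiding \<open>B\<close> would represent \<open>B\<close> by ideals
  strictly above it, any one of which could be dropped because \<open>B\<close> is prime for intersection.
\<close>

section \<open>Preliminaries on Noetherian spaces and ideals\<close>

lemma noetherian_space_maximal:
  assumes X: "noetherian_space X" and U: "\<And>U. U \<in> \<U> \<Longrightarrow> openin X U" and ne: "\<U> \<noteq> {}"
  shows "\<exists>U\<in>\<U>. \<forall>V\<in>\<U>. \<not> U \<subset> V"
proof (rule ccontr)
  assume "\<not> ?thesis"
  then have step: "\<exists>V\<in>\<U>. U \<subset> V" if "U \<in> \<U>" for U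
    using that by blast
  obtain f where f: "f n \<in> \<U>" "f n \<subset> f (Suc n)" for n :: nat
    using dependent_nat_choice[of "\<lambda>_ U. U \<in> \<U>" "\<lambda>_. (\<subset>)"] ne step by (metis all_not_in_conv)
  have "(\<forall>n. openin X (f n)) \<and> (\<forall>n. f n \<subseteq> f (Suc n))"
    using f(1)[THEN U] f(2)[THEN psubset_imp_subset] by blast
  then obtain N where "\<forall>n\<ge>N. f n = f N"
    using X unfolding noetherian_space_def by metis
  then have "f (Suc N) = f N" using le_Suc_eq by blast
  with f(2)[of N] show False by blast
qed

lemma (in cring) ideal_by_closureI:
  assumes "I \<subseteq> carrier R" "\<zero> \<in> I"
    and add: "\<And>x y. x \<in> I \<Longrightarrow> y \<in> I \<Longrightarrow> x \<oplus> y \<in> I"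
    and mult: "\<And>r x. r \<in> carrier R \<Longrightarrow> x \<in> I \<Longrightarrow> r \<otimes> x \<in> I"
  shows "ideal I R"
proof (rule idealI[OF ring_axioms])
  show "subgroup I (add_monoid R)"
  proof (rule add.subgroupI)
    show "\<ominus> x \<in> I" if "x \<in> I" for x
      using mult[of "\<ominus> \<one>" x] that assms(1) by (auto simp: l_minus)
  qed (use assms in auto)
  fix x r assume xr: "x \<in> I" "r \<in> carrier R"
  show "r \<otimes> x \<in> I" using mult xr by blast
  then show "x \<otimes> r \<in> I" using xr assms(1) m_comm by force
qed

lemma (in cring) exists_maximalideal_superset:
  assumes A: "ideal A R" "A \<noteq> carrier R"
  shows "\<exists>M. maximalideal M R \<and> A \<subseteq> M"
proof -
  \<comment> \<open>Properness is encoded as \<open>\<one> \<notin> I\<close>, a condition that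
    passes to unions of chains.\<close>
  let ?F = "{I. ideal I R \<and> A \<subseteq> I \<and> \<one> \<notin> I}"
  have "\<exists>M\<in>?F. \<forall>X\<in>?F. M \<subseteq> X \<longrightarrow> X = M"
  proof (rule subset_Zorn_nonempty)
    show "?F \<noteq> {}" using A ideal.one_imp_carrier by blast
    fix C assume C: "C \<noteq> {}" "subset.chain ?F C"
    then have *: "I \<in> ?F" if "I \<in> C" for I
      using that by (auto simp: subset.chain_def)
    have "subset.chain {I. ideal I R} C"
      using C by (auto simp: subset.chain_def)
    then have "ideal (\<Union>C) R"
      using chain_Union_is_ideal[of C] C(1) by simp
    then show "\<Union>C \<in> ?F" using C(1) * by blast
  qed
  then obtain M where M: "M \<in> ?F" "\<forall>X\<in>?F. M \<subseteq> X \<longrightarrow> X = M" by (rule bexE)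
  have "maximalideal M R"
  proof (rule maximalidealI)
    show "ideal M R" using M(1) by blast
    show "carrier R \<noteq> M" using M(1) by blast
    fix J assume J: "ideal J R" "M \<subseteq> J" "J \<subseteq> carrier R"
    show "J = M \<or> J = carrier R"
    proof (cases "\<one> \<in> J")
      case True then show ?thesis using ideal.one_imp_carrier[OF J(1)] by blast
    next
      case False then show ?thesis using M J by blast
    qed
  qed
  then show ?thesis using M(1) by blast
qed

section \<open>Saturations and colon ideals\<close>

definition saturation :: "('a, 'm) ring_scheme \<Rightarrow> 'a set \<Rightarrow> 'a set \<Rightarrow> 'a set"
  where "saturation R M A = {r \<in> carrier R. \<exists>s \<in> carrier R - M. s \<otimes>\<^bsub>R\<^esub> r \<in> A}"

text \<open>The colon ideal \<open>A : x\<close>. It translates membership of \<open>x\<close> in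
  \<open>A\<close> and in its saturations into statements about maximal ideals.\<close>

definition ann_mod :: "('a, 'm) ring_scheme \<Rightarrow> 'a set \<Rightarrow> 'a \<Rightarrow> 'a set"
  where "ann_mod R A x = {r \<in> carrier R. r \<otimes>\<^bsub>R\<^esub> x \<in> A}"

context cring
begin

lemma maximalideal_compl_mult:
  assumes "maximalideal M R" "s \<in> carrier R - M" "t \<in> carrier R - M"
  shows "s \<otimes> t \<in> carrier R - M"
  using primeideal.I_prime[OF maximalideal_prime[OF assms(1)]] assms(2,3) by blast

lemma one_notin_maximalideal:
  assumes "maximalideal M R" shows "\<one> \<notin> M"
  using assms ideal.one_imp_carrier maximalideal.I_notcarr maximalideal_def by blast

lemma mult_set_compl_maximalideal:
  assumes "maximalideal M R" shows "mult_set R (carrier R - M)"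
  using one_notin_maximalideal[OF assms] maximalideal_compl_mult[OF assms]
  by (intro mult_set.intro mult_set_axioms.intro is_cring) auto

lemma ideal_ann_mod:
  assumes A: "ideal A R" and x: "x \<in> carrier R"
  shows "ideal (ann_mod R A x) R"
proof -
  interpret A: ideal A R by fact
  show ?thesis
    by (rule ideal_by_closureI) (use x in \<open>auto simp: ann_mod_def l_distr m_assoc A.I_l_closed\<close>)
qed

lemma one_in_ann_mod_iff: "x \<in> carrier R \<Longrightarrow> \<one> \<in> ann_mod R A x \<longleftrightarrow> x \<in> A"
  by (simp add: ann_mod_def)

lemma saturation_superset:
  assumes "maximalideal M R" "ideal A R"
  shows "A \<subseteq> saturation R M A"
  using one_notin_maximalideal[OF assms(1)] ideal.Icarr[OF assms(2)]
  by (force simp: saturation_def)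

lemma ideal_saturation:
  assumes M: "maximalideal M R" and A: "ideal A R"
  shows "ideal (saturation R M A) R"
proof -
  interpret A: ideal A R by fact
  show ?thesis
  proof (rule ideal_by_closureI)
    show "saturation R M A \<subseteq> carrier R" by (auto simp: saturation_def)
    show "\<zero> \<in> saturation R M A"
      using saturation_superset[OF M A] A.zero_closed by blast
  next
    fix x y assume "x \<in> saturation R M A" "y \<in> saturation R M A"
    then obtain s t where *: "x \<in> carrier R" "s \<in> carrier R - M" "s \<otimes> x \<in> A"
      "y \<in> carrier R" "t \<in> carrier R - M" "t \<otimes> y \<in> A"
      by (auto simp: saturation_def)
    have "s \<otimes> t \<otimes> (x \<oplus> y) = t \<otimes> (s \<otimes> x) \<oplus> s \<otimes> (t \<otimes> y)"
      using * by (simp add: r_distr m_ac)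
    also have "\<dots> \<in> A" using * by (auto intro!: A.a_closed A.I_l_closed)
    finally show "x \<oplus> y \<in> saturation R M A"
      using * maximalideal_compl_mult[OF M] by (auto simp: saturation_def)
  next
    fix r x assume r: "r \<in> carrier R" and "x \<in> saturation R M A"
    then obtain s where *: "x \<in> carrier R" "s \<in> carrier R - M" "s \<otimes> x \<in> A"
      by (auto simp: saturation_def)
    have "s \<otimes> (r \<otimes> x) = r \<otimes> (s \<otimes> x)" using * r by (simp add: m_ac)
    also have "\<dots> \<in> A" using * r by (auto intro!: A.I_l_closed)
    finally show "r \<otimes> x \<in> saturation R M A" using * r by (auto simp: saturation_def)
  qed
qed

text \<open>Two multipliers outside \<open>M\<close> compose to one, since \<open>M\<close> is
  prime. Elements outside \<open>M\<close> can thus be cancelled modulo a saturation.\<close>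

lemma saturation_idem:
  assumes M: "maximalideal M R" and "s \<in> carrier R - M" "a \<in> carrier R" "s \<otimes> a \<in> saturation R M A"
  shows "a \<in> saturation R M A"
proof -
  obtain t where t: "t \<in> carrier R - M" "t \<otimes> (s \<otimes> a) \<in> A"
    using assms by (auto simp: saturation_def)
  have "t \<otimes> s \<otimes> a \<in> A" using t assms by (simp add: m_assoc)
  then show ?thesis
    using maximalideal_compl_mult[OF M t(1) assms(2)] assms(3) by (auto simp: saturation_def)
qed

lemma saturation_mono: "A \<subseteq> B \<Longrightarrow> saturation R M A \<subseteq> saturation R M B"
  by (auto simp: saturation_def)

lemma in_saturation_iff:
  "x \<in> carrier R \<Longrightarrow> x \<in> saturation R M A \<longleftrightarrow> \<not> ann_mod R A x \<subseteq> M"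
  by (auto simp: saturation_def ann_mod_def)

text \<open>
  By irreducibility, the elements \<open>r\<close> for which multiplication by \<open>r\<close> on \<open>R/B\<close> is not
  injective form a proper ideal; any maximal ideal containing it works.
\<close>

lemma irreducible_ideal_saturated:
  assumes B: "B \<in> Irr R"
  obtains M where "maximalideal M R" "saturation R M B = B"
proof -
  have iB: "ideal B R" and ne: "B \<noteq> carrier R"
    and irr: "\<And>I J. ideal I R \<Longrightarrow> ideal J R \<Longrightarrow> B \<subset> I \<Longrightarrow> B \<subset> J \<Longrightarrow> B \<noteq> I \<inter> J"
    using B by (auto simp: Irr_def irreducible_ideal_def)
  interpret B: ideal B R by fact
  \<comment> \<open>\<open>Q r\<close> is the preimage in \<open>R\<close> of the kernel of
    multiplication by \<open>r\<close> on \<open>R/B\<close>.\<close>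
  define Q where "Q r = {x \<in> carrier R. r \<otimes> x \<in> B}" for r
  have iQ: "ideal (Q r) R" if "r \<in> carrier R" for r
    by (rule ideal_by_closureI)
      (use that in \<open>auto simp: Q_def r_distr m_lcomm[of r] B.I_l_closed\<close>)
  have BQ: "B \<subseteq> Q r" if "r \<in> carrier R" for r
    using that by (auto simp: Q_def B.I_l_closed)
  define P where "P = {r \<in> carrier R. \<not> Q r \<subseteq> B}"
  have "ideal P R"
  proof (rule ideal_by_closureI)
    show "P \<subseteq> carrier R" by (auto simp: P_def)
    show "\<zero> \<in> P" using ne B.Icarr by (auto simp: P_def Q_def)
    fix r s assume rs: "r \<in> P" "s \<in> P"
    then have c: "r \<in> carrier R" "s \<in> carrier R" by (auto simp: P_def)
    then have "B \<noteq> Q r \<inter> Q s"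
      using rs irr[OF iQ iQ] BQ by (auto simp: P_def)
    then obtain x where x: "x \<in> Q r" "x \<in> Q s" "x \<notin> B"
      using BQ c by blast
    then have "x \<in> Q (r \<oplus> s)" using c by (auto simp: Q_def l_distr)
    then show "r \<oplus> s \<in> P" using x c by (auto simp: P_def)
  next
    fix r s assume r: "r \<in> carrier R" and "s \<in> P"
    then have s: "s \<in> carrier R" "\<not> Q s \<subseteq> B" by (auto simp: P_def)
    have "Q s \<subseteq> Q (r \<otimes> s)" using r s by (auto simp: Q_def m_assoc B.I_l_closed)
    then show "r \<otimes> s \<in> P" using r s by (auto simp: P_def)
  qed
  moreover have "P \<noteq> carrier R"
  proof -
    have "\<one> \<notin> P" by (auto simp: P_def Q_def)
    then show ?thesis by auto
  qed
  ultimately obtain M where M: "maximalideal M R" "P \<subseteq> M"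
    using exists_maximalideal_superset by blast
  \<comment> \<open>A multiplier outside \<open>M\<close> is outside \<open>P\<close>, hence acts
    injectively on \<open>R/B\<close>.\<close>
  have "saturation R M B \<subseteq> B"
    using M(2) by (auto simp: saturation_def P_def Q_def)
  then show ?thesis using that M(1) saturation_superset[OF M(1) iB] by blast
qed

lemma openin_zariski_Max:
  assumes "ideal I R"
  shows "openin (zariski_Max R) {M \<in> MaxSpec R. \<not> I \<subseteq> M}"
proof -
  have "MaxSpec R \<subseteq> Spec R" using maximalideal_prime by (auto simp: MaxSpec_def Spec_def)
  then have "{M \<in> MaxSpec R. \<not> I \<subseteq> M} = {P \<in> Spec R. \<not> I \<subseteq> P} \<inter> MaxSpec R" by auto
  moreover have "openin (zariski R) {P \<in> Spec R. \<not> I \<subseteq> P}"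
    using assms openin_zariski[OF is_cring] by blast
  ultimately show ?thesis
    unfolding zariski_Max_def openin_subtopology by (intro exI conjI)
qed

end

section \<open>Irreducible ideals of arithmetical rings\<close>

locale arithmetical = cring R for R (structure) +
  assumes arithmetical: "arithmetical_ring R"
begin

text \<open>The principal ideals of \<open>a/1\<close> and \<open>b/1\<close> in the localization
  are comparable. Clearing denominators in \<open>a/1 = (c/t)(b/1)\<close> gives
  \<open>(u \<otimes> t) \<otimes> a = (u \<otimes> c) \<otimes> b\<close> with \<open>u\<close> and
  \<open>t\<close> outside \<open>M\<close>.\<close>

lemma divides_up_to_unit:
  assumes M: "maximalideal M R" and a: "a \<in> carrier R" and b: "b \<in> carrier R"
  shows "\<exists>s \<in> carrier R - M. s \<otimes> a \<in> PIdl b \<or> s \<otimes> b \<in> PIdl a"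
proof -
  define S where "S = carrier R - M"
  interpret L: mult_set R S unfolding S_def by (rule mult_set_compl_maximalideal[OF M])
  interpret Loc: cring "localization R S" by (rule L.cring_localization)
  have *: "\<exists>s \<in> S. s \<otimes> x \<in> PIdl y"
    if xy: "x \<in> carrier R" "y \<in> carrier R"
      and "PIdl\<^bsub>localization R S\<^esub> (loc_frac R S x \<one>) \<subseteq> PIdl\<^bsub>localization R S\<^esub> (loc_frac R S y \<one>)" for x y
  proof -
    have "loc_frac R S x \<one> \<in> PIdl\<^bsub>localization R S\<^esub> (loc_frac R S y \<one>)"
      using that Loc.cgenideal_self L.loc_fracI L.S_one by blast
    then obtain X where X: "X \<in> carrier (localization R S)"
      "loc_frac R S x \<one> = X \<otimes>\<^bsub>localization R S\<^esub> loc_frac R S y \<one>"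
      unfolding cgenideal_def by blast
    then obtain c t where ct: "c \<in> carrier R" "t \<in> S"
      "loc_frac R S x \<one> = loc_frac R S c t \<otimes>\<^bsub>localization R S\<^esub> loc_frac R S y \<one>"
      unfolding L.loc_carrier by blast
    have tc: "t \<in> carrier R" using ct L.S_carrier by blast
    have "loc_frac R S x \<one> = loc_frac R S (c \<otimes> y) t"
      using ct xy tc L.S_one by (simp add: L.loc_mult)
    then have "((x, \<one>), (c \<otimes> y, t)) \<in> loc_rel R S"
      using eq_equiv_class[OF _ L.loc_equiv] ct xy unfolding loc_frac_def by blast
    then obtain u where u: "u \<in> S" "u \<otimes> (x \<otimes> t) = u \<otimes> (c \<otimes> y \<otimes> \<one>)"
      by (auto simp: loc_rel_def)
    have uc: "u \<in> carrier R" using u L.S_carrier by blast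
    have "(u \<otimes> t) \<otimes> x = (u \<otimes> c) \<otimes> y"
      using u(2) xy uc tc ct(1) by (simp add: m_ac)
    then have "(u \<otimes> t) \<otimes> x \<in> PIdl y" using uc ct(1) unfolding cgenideal_def by blast
    then show ?thesis using u(1) ct(2) L.S_mult by blast
  qed
  \<comment> \<open>The chain condition on ideals of the localization enters here.\<close>
  have "PIdl\<^bsub>localization R S\<^esub> (loc_frac R S a \<one>) \<subseteq> PIdl\<^bsub>localization R S\<^esub> (loc_frac R S b \<one>) \<or>
    PIdl\<^bsub>localization R S\<^esub> (loc_frac R S b \<one>) \<subseteq> PIdl\<^bsub>localization R S\<^esub> (loc_frac R S a \<one>)"
    using arithmetical M Loc.cgenideal_ideal L.loc_fracI L.S_one a b
    unfolding arithmetical_ring_def S_def by blast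
  then show ?thesis using *[OF a b] *[OF b a] unfolding S_def by blast
qed

text \<open>For \<open>a \<in> I\<close> and \<open>b \<in> J\<close> outside the saturation, one
  divides the other up to a multiplier \<open>s\<close> outside \<open>M\<close>. So
  \<open>s \<otimes> a\<close> or \<open>s \<otimes> b\<close> lies in \<open>I \<inter> J\<close>,
  and cancelling \<open>s\<close> gives a contradiction.\<close>

lemma saturated_strongly_irreducible:
  assumes M: "maximalideal M R" and "ideal I R" "ideal J R"
    and sub: "I \<inter> J \<subseteq> saturation R M A"
  shows "I \<subseteq> saturation R M A \<or> J \<subseteq> saturation R M A"
proof (rule ccontr)
  assume "\<not> ?thesis"
  then obtain a b where ab: "a \<in> I" "b \<in> J" "a \<notin> saturation R M A" "b \<notin> saturation R M A"
    by blast
  have c: "a \<in> carrier R" "b \<in> carrier R" using ab ideal.Icarr[OF assms(2)] ideal.Icarr[OF assms(3)] by auto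
  obtain s where s: "s \<in> carrier R - M" and or: "s \<otimes> a \<in> PIdl b \<or> s \<otimes> b \<in> PIdl a"
    using divides_up_to_unit[OF M c] by blast
  have "s \<otimes> a \<in> I" "s \<otimes> b \<in> J"
    using s ab ideal.I_l_closed[OF assms(2)] ideal.I_l_closed[OF assms(3)] by auto
  moreover have "PIdl b \<subseteq> J" "PIdl a \<subseteq> I"
    using cgenideal_minimal[OF assms(2)] cgenideal_minimal[OF assms(3)] ab by auto
  ultimately have "s \<otimes> a \<in> saturation R M A \<or> s \<otimes> b \<in> saturation R M A" using or sub by blast
  then show False using saturation_idem[OF M s] c ab(3,4) by blast
qed

lemma irreducible_ideal_strongly:
  assumes "B \<in> Irr R" "ideal I R" "ideal J R" "I \<inter> J \<subseteq> B"
  shows "I \<subseteq> B \<or> J \<subseteq> B"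
  using irreducible_ideal_saturated[OF assms(1)] saturated_strongly_irreducible[OF _ assms(2,3)] assms(4)
  by metis

lemma Irr_I:
  assumes "ideal B R" "B \<noteq> carrier R"
    and "\<And>I J. ideal I R \<Longrightarrow> ideal J R \<Longrightarrow> I \<inter> J \<subseteq> B \<Longrightarrow> I \<subseteq> B \<or> J \<subseteq> B"
  shows "B \<in> Irr R"
  using assms unfolding Irr_def irreducible_ideal_def by blast

lemma ideal_of_Irr: "B \<in> Irr R \<Longrightarrow> ideal B R"
  by (simp add: Irr_def irreducible_ideal_def)

lemma saturation_in_V_Irr:
  assumes M: "maximalideal M R" and A: "ideal A R" and "A \<subseteq> M"
  shows "saturation R M A \<in> V_Irr R A"
proof -
  \<comment> \<open>Otherwise some \<open>s\<close> outside \<open>M\<close> would lie in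
    \<open>A\<close>, against \<open>A \<subseteq> M\<close>.\<close>
  have "\<one> \<notin> saturation R M A" using assms(3) by (auto simp: saturation_def)
  then have "saturation R M A \<in> Irr R"
    using ideal_saturation[OF M A] saturated_strongly_irreducible[OF M] by (intro Irr_I) auto
  then show ?thesis using saturation_superset[OF M A] by (simp add: V_Irr_def)
qed

text \<open>If \<open>x \<notin> A\<close>, then \<open>A : x\<close> is proper and lies in some
  maximal \<open>M\<close>. The saturation of \<open>A\<close> at \<open>M\<close> is an irreducible
  ideal over \<open>A\<close> that misses \<open>x\<close>.\<close>

lemma Inter_V_Irr:
  assumes A: "ideal A R"
  shows "carrier R \<inter> \<Inter>(V_Irr R A) \<subseteq> A"
proof
  fix x assume x: "x \<in> carrier R \<inter> \<Inter>(V_Irr R A)"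
  show "x \<in> A"
  proof (rule ccontr)
    assume "x \<notin> A"
    then have "ann_mod R A x \<noteq> carrier R" using x one_in_ann_mod_iff by blast
    then obtain M where M: "maximalideal M R" "ann_mod R A x \<subseteq> M"
      using exists_maximalideal_superset ideal_ann_mod[OF A] x by blast
    have "A \<subseteq> ann_mod R A x"
      using x ideal.I_r_closed[OF A] ideal.Icarr[OF A] by (auto simp: ann_mod_def)
    then have "saturation R M A \<in> V_Irr R A" using saturation_in_V_Irr M A by blast
    moreover have "x \<notin> saturation R M A" using in_saturation_iff x M(2) by blast
    ultimately show False using x by blast
  qed
qed

section \<open>Minimal irreducible ideals over \<open>A\<close>\<close>

text \<open>If \<open>I\<close> is not inside \<open>D\<close> and \<open>J\<close> is not inside
  \<open>E\<close>, the smaller of \<open>D\<close> and \<open>E\<close> contains neither, although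
  it is prime for intersection.\<close>

lemma Inter_chain_Irr:
  assumes "C \<noteq> {}" "C \<subseteq> Irr R" and chain: "\<And>I J. I \<in> C \<Longrightarrow> J \<in> C \<Longrightarrow> I \<subseteq> J \<or> J \<subseteq> I"
  shows "\<Inter>C \<in> Irr R"
proof (rule Irr_I)
  show "ideal (\<Inter>C) R" using assms(1,2) ideal_of_Irr by (intro i_Intersect) auto
  obtain D where "D \<in> C" using assms(1) by blast
  moreover have "D \<subseteq> carrier R" "D \<noteq> carrier R" if "D \<in> C" for D
    using that assms(2) ideal.Icarr[OF ideal_of_Irr] by (auto simp: Irr_def)
  ultimately show "\<Inter>C \<noteq> carrier R" by blast
  fix I J assume IJ: "ideal I R" "ideal J R" "I \<inter> J \<subseteq> \<Inter>C"
  show "I \<subseteq> \<Inter>C \<or> J \<subseteq> \<Inter>C"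
  proof (rule ccontr)
    assume "\<not> ?thesis"
    then obtain D E where DE: "D \<in> C" "E \<in> C" "\<not> I \<subseteq> D" "\<not> J \<subseteq> E" by blast
    then obtain F where "F \<in> C" "\<not> I \<subseteq> F" "\<not> J \<subseteq> F" using chain by blast
    then show False using irreducible_ideal_strongly[of F I J] IJ assms(2) by blast
  qed
qed

lemma minimal_irr_over_below:
  assumes B: "B \<in> V_Irr R A"
  shows "\<exists>C \<in> minimal_irr_over R A. C \<subseteq> B"
proof -
  have sub: "C \<subseteq> carrier R" if "C \<in> Irr R" for C
    using that ideal.Icarr[OF ideal_of_Irr] by blast
  let ?V = "{C \<in> V_Irr R A. C \<subseteq> B}"
  \<comment> \<open>Complements turn the search for a minimal element into one for a maximal
    element, so that Zorn's lemma for unions of chains applies.\<close>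
  let ?F = "(\<lambda>C. carrier R - C) ` ?V"
  have "\<exists>M \<in> ?F. \<forall>X \<in> ?F. M \<subseteq> X \<longrightarrow> X = M"
  proof (rule subset_Zorn_nonempty)
    show "?F \<noteq> {}" using B by blast
    fix K assume K: "K \<noteq> {}" "subset.chain ?F K"
    define D where "D = {C \<in> ?V. carrier R - C \<in> K}"
    have KD: "K = (\<lambda>C. carrier R - C) ` D"
      using K by (auto simp: D_def subset.chain_def)
    have "D \<noteq> {}" using K KD by blast
    have DI: "D \<subseteq> Irr R" by (auto simp: D_def V_Irr_def)
    have "I \<subseteq> J \<or> J \<subseteq> I" if "I \<in> D" "J \<in> D" for I J
    proof -
      have "carrier R - I \<in> K" "carrier R - J \<in> K" using that by (auto simp: D_def)
      then have "carrier R - I \<subseteq> carrier R - J \<or> carrier R - J \<subseteq> carrier R - I"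
        using subset.chain_total[OF K(2)] by blast
      then show ?thesis using that DI sub by blast
    qed
    then have "\<Inter>D \<in> Irr R" using Inter_chain_Irr \<open>D \<noteq> {}\<close> DI by blast
    then have "\<Inter>D \<in> ?V" using \<open>D \<noteq> {}\<close> by (auto simp: D_def V_Irr_def)
    moreover have "\<Union>K = carrier R - \<Inter>D" unfolding KD using \<open>D \<noteq> {}\<close> by blast
    ultimately show "\<Union>K \<in> ?F" by blast
  qed
  then obtain M where "M \<in> ?F" and M: "\<forall>X \<in> ?F. M \<subseteq> X \<longrightarrow> X = M" by (rule bexE)
  then obtain C where C: "C \<in> ?V" "M = carrier R - C" by blast
  have max: "carrier R - D = carrier R - C" if "D \<in> ?V" "carrier R - C \<subseteq> carrier R - D" for D
    using M that C(2) by blast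
  have "D = C" if D: "D \<in> V_Irr R A" "D \<subseteq> C" for D
    using max[of D] C D sub[of C] sub[of D] unfolding V_Irr_def by blast
  then have "C \<in> minimal_irr_over R A" using C by (auto simp: minimal_irr_over_def)
  then show ?thesis using C by blast
qed

lemma minimal_irr_over_representation:
  assumes A: "ideal A R"
  shows "representation R A (minimal_irr_over R A)"
proof -
  have "carrier R \<inter> \<Inter>(minimal_irr_over R A) \<subseteq> carrier R \<inter> \<Inter>(V_Irr R A)"
    using minimal_irr_over_below by blast
  also have "\<dots> \<subseteq> A" by (rule Inter_V_Irr[OF A])
  finally show ?thesis
    using ideal.Icarr[OF A] by (auto simp: representation_def minimal_irr_over_def V_Irr_def)
qed

text \<open>
  Among the elements of \<open>J - B\<close> take \<open>a\<close> with the closed set of maximal ideals over \<open>A : a\<close>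
  minimal. Any irreducible \<open>C\<close> violating the claim would yield an element of \<open>J - B\<close> with a
  strictly smaller closed set.
\<close>

lemma separating_element:
  assumes noeth: "noetherian_space (zariski_Max R)"
    and A: "ideal A R" and B: "B \<in> minimal_irr_over R A" and J: "ideal J R" "\<not> J \<subseteq> B"
  shows "\<exists>a \<in> J - B. \<forall>C \<in> V_Irr R A. \<not> B \<subseteq> C \<longrightarrow> a \<in> C"
proof -
  \<comment> \<open>The open complement of the closed set of maximal ideals over
    \<open>A : a\<close>, so a maximal \<open>U a\<close> means a minimal closed set.\<close>
  define U where "U a = {M \<in> MaxSpec R. \<not> ann_mod R A a \<subseteq> M}" for a
  have Jc: "x \<in> carrier R" if "x \<in> J" for x using that ideal.Icarr[OF J(1)] by blast
  have "\<exists>W \<in> U ` (J - B). \<forall>W' \<in> U ` (J - B). \<not> W \<subset> W'"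
  proof (rule noetherian_space_maximal[OF noeth])
    show "openin (zariski_Max R) W" if "W \<in> U ` (J - B)" for W
      using that openin_zariski_Max ideal_ann_mod[OF A] Jc unfolding U_def by blast
  qed (use J in auto)
  then obtain a where a: "a \<in> J" "a \<notin> B" and max: "\<And>c. c \<in> J \<Longrightarrow> c \<notin> B \<Longrightarrow> \<not> U a \<subset> U c"
    by blast
  have BI: "B \<in> Irr R" "A \<subseteq> B" and Bmin: "\<And>C. C \<in> V_Irr R A \<Longrightarrow> C \<subseteq> B \<Longrightarrow> C = B"
    using B by (auto simp: minimal_irr_over_def V_Irr_def)
  have "a \<in> C" if C: "C \<in> V_Irr R A" "\<not> B \<subseteq> C" for C
  proof (rule ccontr)
    assume "a \<notin> C"
    have CI: "C \<in> Irr R" "A \<subseteq> C" using C by (auto simp: V_Irr_def)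
    obtain N where N: "maximalideal N R" "saturation R N C = C"
      using irreducible_ideal_saturated[OF CI(1)] by blast
    let ?S = "saturation R N A"
    have SC: "?S \<subseteq> C" using saturation_mono[OF CI(2)] N(2) by blast
    \<comment> \<open>An \<open>x \<in> A\<close> outside \<open>N\<close> would multiply
      \<open>a\<close> into \<open>A\<close>, placing \<open>a\<close> in
      \<open>?S \<subseteq> C\<close>.\<close>
    have "A \<subseteq> N"
    proof
      fix x assume x: "x \<in> A"
      then have xc: "x \<in> carrier R" using ideal.Icarr[OF A] by blast
      show "x \<in> N"
      proof (rule ccontr)
        assume "x \<notin> N"
        moreover have "x \<otimes> a \<in> A" using x a Jc ideal.I_r_closed[OF A] by blast
        ultimately have "a \<in> ?S" using xc a Jc by (auto simp: saturation_def)
        then show False using SC \<open>a \<notin> C\<close> by blast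
      qed
    qed
    then have SV: "?S \<in> V_Irr R A" by (rule saturation_in_V_Irr[OF N(1) A])
    \<comment> \<open>By minimality \<open>?S \<subseteq> B\<close> would mean
      \<open>?S = B\<close>, hence \<open>B \<subseteq> C\<close>.\<close>
    have nSB: "\<not> ?S \<subseteq> B" using Bmin[OF SV] SC C(2) by blast
    have iP: "ideal (PIdl a) R" "\<not> PIdl a \<subseteq> B"
      using cgenideal_ideal[OF Jc] cgenideal_self[OF Jc] a by auto
    have iS: "ideal ?S R" by (rule ideal_saturation[OF N(1) A])
    have "\<not> ?S \<inter> PIdl a \<subseteq> B"
      using irreducible_ideal_strongly[OF BI(1) iS iP(1)] nSB iP(2) by blast
    then obtain c where c: "c \<in> ?S" "c \<in> PIdl a" "c \<notin> B" by blast
    then obtain r where r: "r \<in> carrier R" "c = r \<otimes> a" by (auto simp: cgenideal_def)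
    have cJ: "c \<in> J" using r a ideal.I_l_closed[OF J(1)] by blast
    have "ann_mod R A a \<subseteq> ann_mod R A c"
      using r a Jc ideal.I_l_closed[OF A]
      by (auto simp: ann_mod_def m_lcomm[of _ r a])
    then have "U a \<subseteq> U c" unfolding U_def by blast
    \<comment> \<open>\<open>c\<close> lies in the saturation at \<open>N\<close>, whereas
      \<open>a\<close> does not because \<open>a \<notin> C\<close>. The multiple \<open>c\<close>
      of \<open>a\<close> thus strictly enlarges the open set.\<close>
    moreover have "N \<in> U c" "N \<notin> U a"
      using c(1) in_saturation_iff[of c N A] in_saturation_iff[of a N A] SC \<open>a \<notin> C\<close> a cJ Jc N(1)
      by (auto simp: U_def MaxSpec_def)
    ultimately show False using max[OF cJ c(3)] by blast
  qed
  then show ?thesis using a by blast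
qed

section \<open>The topology of \<open>Irr R\<close> and strong irredundancy\<close>

text \<open>Induction over the generation of \<open>U\<close>. At finite intersections,
  \<open>I \<inter> J\<close> stays outside \<open>B\<close> because \<open>B\<close> is prime for
  intersection.\<close>

lemma openin_irr_topology_nhd:
  assumes U: "openin (irr_topology R) U" and B: "B \<in> Irr R" and "B \<in> U"
  shows "\<exists>J. ideal J R \<and> \<not> J \<subseteq> B \<and> (\<forall>C \<in> Irr R. C \<notin> U \<longrightarrow> J \<subseteq> C)"
proof -
  have "generate_topology_on {Irr R - V_Irr R I | I. ideal I R} U"
    using U by (simp add: irr_topology_def openin_topology_generated_by_iff)
  then show ?thesis using \<open>B \<in> U\<close>
  proof induction
    case (Int U W)
    then obtain I J where I: "ideal I R" "\<not> I \<subseteq> B" "\<forall>C \<in> Irr R. C \<notin> U \<longrightarrow> I \<subseteq> C"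
      and J: "ideal J R" "\<not> J \<subseteq> B" "\<forall>C \<in> Irr R. C \<notin> W \<longrightarrow> J \<subseteq> C" by blast
    have "\<not> I \<inter> J \<subseteq> B" using irreducible_ideal_strongly[OF B] I(1,2) J(1,2) by blast
    then show ?case using I J i_intersect[of I J] by blast
  next
    case (UN K)
    then obtain k where k: "k \<in> K" "B \<in> k" by blast
    from UN.IH[OF k] obtain J where
      J: "ideal J R" "\<not> J \<subseteq> B" "\<forall>C \<in> Irr R. C \<notin> k \<longrightarrow> J \<subseteq> C" by blast
    have "J \<subseteq> C" if "C \<in> Irr R" "C \<notin> \<Union>K" for C
      using J(3) k(1) that by blast
    then show ?case using J(1,2) by blast
  next
    case (Basis s) then show ?case by (auto simp: V_Irr_def)
  qed simp
qed

text \<open>Closed sets are upward closed in \<open>Irr R\<close>, so a closed set containing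
  \<open>B\<close> contains all of \<open>V_Irr R B\<close>. A proper closed subset therefore omits
  \<open>B\<close> and is separated from it by an ideal.\<close>

lemma closedin_V_Irr_separation:
  assumes B: "B \<in> Irr R" and Y: "closedin (subtopology (irr_topology R) (V_Irr R B)) Y"
    and ne: "Y \<noteq> V_Irr R B"
  shows "\<exists>J. ideal J R \<and> \<not> J \<subseteq> B \<and> (\<forall>C \<in> Y. J \<subseteq> C)"
proof -
  obtain T where T: "closedin (irr_topology R) T" "Y = T \<inter> V_Irr R B"
    using Y by (auto simp: closedin_subtopology)
  have U: "openin (irr_topology R) (Irr R - T)"
    using T(1) by (simp add: closedin_def topspace_irr_topology[OF ring_axioms])
  obtain D where D: "D \<in> V_Irr R B" "D \<notin> T" using ne T(2) by blast
  have "B \<notin> T"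
  proof
    assume "B \<in> T"
    obtain J where "\<not> J \<subseteq> D" "\<forall>C \<in> Irr R. C \<notin> Irr R - T \<longrightarrow> J \<subseteq> C"
      using openin_irr_topology_nhd[OF U, of D] D unfolding V_Irr_def by blast
    then show False using \<open>B \<in> T\<close> B D by (auto simp: V_Irr_def)
  qed
  then obtain J where J: "ideal J R" "\<not> J \<subseteq> B" "\<forall>C \<in> Irr R. C \<notin> Irr R - T \<longrightarrow> J \<subseteq> C"
    using openin_irr_topology_nhd[OF U, of B] B by blast
  have "J \<subseteq> C" if "C \<in> Y" for C
    using J(3) that T(2) by (auto simp: V_Irr_def)
  then show ?thesis using J(1,2) by blast
qed

lemma minimal_irr_over_strongly_irredundant:
  assumes noeth: "noetherian_space (zariski_Max R)"
    and A: "ideal A R" and B: "B \<in> minimal_irr_over R A"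
  shows "strongly_irredundant_in R A (minimal_irr_over R A) B"
  unfolding strongly_irredundant_in_def
proof (intro allI iffI)
  let ?Z = "minimal_irr_over R A"
  have BI: "B \<in> Irr R" "A \<subseteq> B" using B by (auto simp: minimal_irr_over_def V_Irr_def)
  note rep = minimal_irr_over_representation[OF A]
  fix Y
  {
    assume Y: "Y = V_Irr R B"
    have "topspace (subtopology (irr_topology R) (V_Irr R B)) = V_Irr R B"
      by (auto simp: topspace_irr_topology[OF ring_axioms] V_Irr_def)
    then have "closedin (subtopology (irr_topology R) (V_Irr R B)) Y"
      using Y closedin_topspace by metis
    moreover have "carrier R \<inter> \<Inter>(?Z - {B} \<union> Y) = carrier R \<inter> \<Inter>?Z"
      using B BI unfolding Y by (auto simp: V_Irr_def)
    then have "representation R A (?Z - {B} \<union> Y)"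
      using rep Y by (auto simp: representation_def V_Irr_def)
    ultimately show "closedin (subtopology (irr_topology R) (V_Irr R B)) Y \<and>
      representation R A (?Z - {B} \<union> Y)" ..
  next
    assume *: "closedin (subtopology (irr_topology R) (V_Irr R B)) Y \<and>
      representation R A (?Z - {B} \<union> Y)"
    show "Y = V_Irr R B"
    proof (rule ccontr)
      assume "Y \<noteq> V_Irr R B"
      then obtain J where J: "ideal J R" "\<not> J \<subseteq> B" "\<forall>C \<in> Y. J \<subseteq> C"
        using closedin_V_Irr_separation[OF BI(1)] * by blast
      obtain a where a: "a \<in> J - B" "\<forall>C \<in> V_Irr R A. \<not> B \<subseteq> C \<longrightarrow> a \<in> C"
        using separating_element[OF noeth A B J(1,2)] by blast
      \<comment> \<open>A minimal \<open>C\<close> other than \<open>B\<close> cannot contain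
        \<open>B\<close>.\<close>
      have "a \<in> C" if "C \<in> ?Z - {B}" for C
        using that a(2) B by (auto simp: minimal_irr_over_def)
      \<comment> \<open>Members of \<open>Y\<close> contain \<open>a\<close> through
        \<open>J\<close>, so \<open>a\<close> lies in \<open>A \<subseteq> B\<close>, contrary to
        its choice.\<close>
      then have "a \<in> carrier R \<inter> \<Inter>(?Z - {B} \<union> Y)"
        using J a(1) ideal.Icarr[OF J(1)] by blast
      also have "\<dots> = A" using * by (simp add: representation_def)
      finally show False using a(1) BI by blast
    qed
  }
qed

section \<open>Irredundancy and uniqueness\<close>

lemma minimal_irr_over_irredundant:
  assumes noeth: "noetherian_space (zariski_Max R)" and A: "ideal A R"
  shows "irredundant_representation R A (minimal_irr_over R A)"
  unfolding irredundant_representation_def irredundant_in_def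
proof (intro conjI ballI notI)
  show "representation R A (minimal_irr_over R A)" by (rule minimal_irr_over_representation[OF A])
  fix B assume B: "B \<in> minimal_irr_over R A"
    and "representation R A (minimal_irr_over R A - {B})"
  \<comment> \<open>Dropping \<open>B\<close> amounts to replacing it by the closed set
    \<open>{}\<close>, so strong irredundancy applies.\<close>
  then have "{} = V_Irr R B"
    using minimal_irr_over_strongly_irredundant[OF noeth A B] closedin_empty
    unfolding strongly_irredundant_in_def by (metis sup_bot_right)
  then show False using B by (auto simp: minimal_irr_over_def V_Irr_def)
qed

lemma minimal_irr_over_subset_irredundant:
  assumes noeth: "noetherian_space (zariski_Max R)" and A: "ideal A R"
    and Z: "irredundant_representation R A Z"
  shows "minimal_irr_over R A \<subseteq> Z"
proof (rule ccontr)
  assume "\<not> ?thesis"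
  then obtain B where B: "B \<in> minimal_irr_over R A" "B \<notin> Z" by blast
  have BI: "B \<in> Irr R" "A \<subseteq> B" using B(1) by (auto simp: minimal_irr_over_def V_Irr_def)
  have ZI: "Z \<subseteq> V_Irr R A" and ZA: "carrier R \<inter> \<Inter>Z = A"
    using Z by (auto simp: irredundant_representation_def representation_def V_Irr_def)
  have ideal_Inter: "ideal (carrier R \<inter> \<Inter>W) R" if "W \<subseteq> Irr R" for W
  proof -
    have "ideal (\<Inter>(insert (carrier R) W)) R"
      using that oneideal ideal_of_Irr by (intro i_Intersect) auto
    then show ?thesis by simp
  qed
  define W where "W = {C \<in> Z. B \<subseteq> C}"
  have WI: "W \<subseteq> Irr R" using ZI by (auto simp: W_def V_Irr_def)
  \<comment> \<open>Otherwise a separating element for the intersection of \<open>W\<close> would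
    lie in every member of \<open>Z\<close>, hence in \<open>A \<subseteq> B\<close>.\<close>
  have WB: "carrier R \<inter> \<Inter>W \<subseteq> B"
  proof (rule ccontr)
    assume "\<not> ?thesis"
    then obtain a where a: "a \<in> carrier R \<inter> \<Inter>W - B" "\<forall>C \<in> V_Irr R A. \<not> B \<subseteq> C \<longrightarrow> a \<in> C"
      using separating_element[OF noeth A B(1) ideal_Inter[OF WI]] by blast
    then have "a \<in> carrier R \<inter> \<Inter>Z" using ZI unfolding W_def by blast
    then show False using ZA a(1) BI by blast
  qed
  \<comment> \<open>The intersection over the empty family is \<open>carrier R\<close>, which does
    not fit inside the proper ideal \<open>B\<close>.\<close>
  have "W \<noteq> {}" using WB BI ideal.Icarr[OF ideal_of_Irr] by (auto simp: Irr_def)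
  then obtain C where C: "C \<in> W" by blast
  have "\<not> C \<subseteq> B" using C B(2) by (auto simp: W_def)
  moreover have "(carrier R \<inter> \<Inter>(W - {C})) \<inter> C \<subseteq> B" using WB by blast
  ultimately have "carrier R \<inter> \<Inter>(W - {C}) \<subseteq> B"
    using irreducible_ideal_strongly[OF BI(1) ideal_Inter[of "W - {C}"] ideal_of_Irr[of C]] WI C
    by blast
  also have "B \<subseteq> C" using C by (simp add: W_def)
  finally have "carrier R \<inter> \<Inter>(Z - {C}) = carrier R \<inter> \<Inter>Z" by (auto simp: W_def)
  then have "representation R A (Z - {C})"
    using ZI ZA by (auto simp: representation_def V_Irr_def)
  then show False
    using Z C by (auto simp: irredundant_representation_def irredundant_in_def W_def)
qed

text \<open>\<open>Z\<close> contains all minimal irreducible ideals over \<open>A\<close>, and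
  these already represent \<open>A\<close>. Any further member could be dropped.\<close>

lemma irredundant_representation_unique:
  assumes noeth: "noetherian_space (zariski_Max R)" and A: "ideal A R"
    and Z: "irredundant_representation R A Z"
  shows "Z = minimal_irr_over R A"
proof (rule ccontr)
  note sub = minimal_irr_over_subset_irredundant[OF assms]
  assume "Z \<noteq> minimal_irr_over R A"
  then obtain C where C: "C \<in> Z" "C \<notin> minimal_irr_over R A" using sub by blast
  have "representation R A (Z - {C})"
  proof -
    have "minimal_irr_over R A \<subseteq> Z - {C}" using sub C by blast
    moreover have "Z \<subseteq> Irr R" "carrier R \<inter> \<Inter>Z = A" "carrier R \<inter> \<Inter>(minimal_irr_over R A) = A"
      using Z minimal_irr_over_representation[OF A]
      by (auto simp: irredundant_representation_def representation_def)
    ultimately show ?thesis unfolding representation_def by blast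
  qed
  then show False using Z C(1) by (auto simp: irredundant_representation_def irredundant_in_def)
qed

end

theorem theorem7p2:
  fixes R :: "('a, 'm) ring_scheme"
  assumes "arithmetical_ring R"
    and "noetherian_space (zariski_Max R)"
  shows "\<forall>A. ideal A R \<and> A \<noteq> carrier R \<longrightarrow>
    strongly_irredundant_representation R A (minimal_irr_over R A) \<and>
    (\<forall>Z. irredundant_representation R A Z \<longleftrightarrow> Z = minimal_irr_over R A)"
proof -
  interpret arithmetical R
    using assms(1) by (simp add: arithmetical_def arithmetical_axioms_def arithmetical_ring_def)
  show ?thesis
    unfolding strongly_irredundant_representation_def
    using minimal_irr_over_representation minimal_irr_over_strongly_irredundant[OF assms(2)]
      minimal_irr_over_irredundant[OF assms(2)] irredundant_representation_unique[OF assms(2)]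
    by blast
qed

end
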